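(* Let $A$ and $B$ be strictly positive operators on a Hilbert space $H$ such that $uA\le B\le vA$ for real numbers $u,v>0$, and let $p,q\in[-1,1]\setminus\{0\}$. If either (i) $u\ge1$ and $-1\le p\le q<0$, or (ii) $v\le 1$ and $0<p\le q\le 1$, then $$T_p(A|B)-\tfrac12 S_p(A|B)\ \le\ T_q(A|B)-\tfrac12 S_q(A|B).$$ If either (iii) $u\ge 1$ and $0<p\le q\le 1$, or (iv) $v\le 1$ and $-1\le p\le q<0$, then $$T_p(A|B)-\tfrac12 S_p(A|B)\ \ge\ T_q(A|B)-\tfrac12 S_q(A|B).$$
   Context: An operator $A\in B(H)$ (bounded linear operators on a Hilbert space $H$) is strictly positive, $A>0$, if $A\ge 0$ and $A$ is invertible. For self-adjoint $X,Y$, $X\le Y$ means $Y-X$ is positive semidefinite. Powers and logarithms are taken by functional calculus. For $A,B>0$: - Generalized relative operator entropy, $r\in\mathbb{R}$: $S_r(A|B)=A^{1/2}(A^{-1/2}BA^{-1/2})^r\log(A^{-1/2}BA^{-1/2})A^{1/2}$. - Tsallis relative operator entropy, $p\in[-1,1]$, $p\ne0$: $T_p(A|B)=\dfrac{A^{1/2}(A^{-1/2}BA^{-1/2})^pA^{1/2}-A}{p}$. *)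

theory Defs
  imports "HOL-Analysis.Analysis" "HOL-Computational_Algebra.Polynomial"
begin

text \<open>The inner product is conjugate-linear in its first argument and linear in its second.\<close>

class complex_inner = real_normed_vector +
  fixes scaleC :: "complex \<Rightarrow> 'a \<Rightarrow> 'a" (infixr "*\<^sub>C" 75)
    and cinner :: "'a \<Rightarrow> 'a \<Rightarrow> complex"
  assumes scaleC_add_right: "c *\<^sub>C (x + y) = c *\<^sub>C x + c *\<^sub>C y"
    and scaleC_add_left: "(c + d) *\<^sub>C x = c *\<^sub>C x + d *\<^sub>C x"
    and scaleC_scaleC: "c *\<^sub>C (d *\<^sub>C x) = (c * d) *\<^sub>C x"
    and scaleC_of_real: "complex_of_real r *\<^sub>C x = r *\<^sub>R x"
    and cinner_commute: "cinner x y = cnj (cinner y x)"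
    and cinner_add_right: "cinner x (y + z) = cinner x y + cinner x z"
    and cinner_scaleC_right: "cinner x (c *\<^sub>C y) = c * cinner x y"
    and cinner_self: "cinner x x = complex_of_real ((norm x)\<^sup>2)"

class complex_hilbert_space = complex_inner + complete_space

instantiation complex :: complex_hilbert_space
begin

definition scaleC_complex :: "complex \<Rightarrow> complex \<Rightarrow> complex"
  where "scaleC_complex c x = c * x"

definition cinner_complex :: "complex \<Rightarrow> complex \<Rightarrow> complex"
  where "cinner_complex x y = cnj x * y"

instance
proof
  show "cinner x x = complex_of_real ((norm x)\<^sup>2)" for x :: complex
    using complex_norm_square[of x] by (simp add: cinner_complex_def mult.commute)
qed (simp_all add: scaleC_complex_def cinner_complex_def scaleR_conv_of_real algebra_simps)

end

lemma norm_scaleC: "norm (c *\<^sub>C x) = cmod c * norm (x :: 'a::complex_inner)"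
proof -
  have left: "cinner (c *\<^sub>C x) (c *\<^sub>C x) = c * (cnj c * cinner x x)"
    by (metis cinner_commute cinner_scaleC_right complex_cnj_mult)
  have "complex_of_real ((norm (c *\<^sub>C x))\<^sup>2) = complex_of_real ((cmod c * norm x)\<^sup>2)"
    using left
    by (simp add: cinner_self power_mult_distrib complex_norm_square mult.assoc
        del: of_real_power)
  then have "(norm (c *\<^sub>C x))\<^sup>2 = (cmod c * norm x)\<^sup>2"
    using of_real_eq_iff by blast
  then show ?thesis
    by (simp add: power2_eq_iff_nonneg)
qed

lemma bounded_linear_scaleC: "bounded_linear (\<lambda>x :: 'a::complex_inner. c *\<^sub>C x)"
proof (rule bounded_linear_intro)
  show "c *\<^sub>C (r *\<^sub>R x) = r *\<^sub>R (c *\<^sub>C x)" for r and x :: 'a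
    by (metis scaleC_of_real scaleC_scaleC mult.commute)
  show "norm (c *\<^sub>C x) \<le> norm x * cmod c" for x :: 'a
    by (simp add: norm_scaleC mult.commute)
qed (rule scaleC_add_right)

text \<open>The library's bounded linear maps are only real-linear; \<open>B(H)\<close> consists of the
  complex-linear ones.\<close>

definition bounded_ops :: "('a::complex_hilbert_space \<Rightarrow>\<^sub>L 'a) set"
  where "bounded_ops = {A :: 'a \<Rightarrow>\<^sub>L 'a. \<forall>c x. A (c *\<^sub>C x) = c *\<^sub>C A x}"

definition invertible_op :: "('a::complex_hilbert_space \<Rightarrow>\<^sub>L 'a) \<Rightarrow> bool"
  where "invertible_op A \<longleftrightarrow>
    (\<exists>B\<in>bounded_ops. A o\<^sub>L B = id_blinfun \<and> B o\<^sub>L A = id_blinfun)"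

definition self_adjoint_op :: "('a::complex_hilbert_space \<Rightarrow>\<^sub>L 'a) \<Rightarrow> bool"
  where "self_adjoint_op A \<longleftrightarrow>
    A \<in> bounded_ops \<and> (\<forall>x y. cinner (A x) y = cinner x (A y))"

definition positive_op :: "('a::complex_hilbert_space \<Rightarrow>\<^sub>L 'a) \<Rightarrow> bool"
  where "positive_op A \<longleftrightarrow> A \<in> bounded_ops \<and> (\<forall>x. cinner x (A x) \<in> \<real>\<^sub>\<ge>\<^sub>0)"

definition strictly_positive_op :: "('a::complex_hilbert_space \<Rightarrow>\<^sub>L 'a) \<Rightarrow> bool"
  where "strictly_positive_op A \<longleftrightarrow> positive_op A \<and> invertible_op A"

definition op_le ::
    "('a::complex_hilbert_space \<Rightarrow>\<^sub>L 'a) \<Rightarrow> ('a \<Rightarrow>\<^sub>L 'a) \<Rightarrow> bool" (infix "\<le>\<^sub>o\<^sub>p" 50)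
  where "X \<le>\<^sub>o\<^sub>p Y \<longleftrightarrow> self_adjoint_op X \<and> self_adjoint_op Y \<and> positive_op (Y - X)"

lift_definition scalar_op :: "complex \<Rightarrow> 'a::complex_hilbert_space \<Rightarrow>\<^sub>L 'a"
  is "\<lambda>c x. c *\<^sub>C x"
  by (rule bounded_linear_scaleC)

definition spectrum :: "('a::complex_hilbert_space \<Rightarrow>\<^sub>L 'a) \<Rightarrow> complex set"
  where "spectrum A = {z. \<not> invertible_op (A - scalar_op z)}"

primrec op_power ::
    "('a::complex_hilbert_space \<Rightarrow>\<^sub>L 'a) \<Rightarrow> nat \<Rightarrow> ('a \<Rightarrow>\<^sub>L 'a)"
  where
    "op_power A 0 = id_blinfun"
  | "op_power A (Suc n) = A o\<^sub>L op_power A n"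

definition op_poly :: "real poly \<Rightarrow> ('a::complex_hilbert_space \<Rightarrow>\<^sub>L 'a) \<Rightarrow> ('a \<Rightarrow>\<^sub>L 'a)"
  where "op_poly P A = (\<Sum>i\<le>degree P. coeff P i *\<^sub>R op_power A i)"

text \<open>For self-adjoint \<open>A\<close> (whose spectrum is real) and \<open>f\<close> real-valued and continuous on the
  spectrum, \<open>f(A)\<close> is the common norm limit of \<open>P\<^sub>n(A)\<close> over all sequences of real
  polynomials \<open>P\<^sub>n\<close> converging to \<open>f\<close> uniformly on the spectrum. Such sequences exist by the
  Weierstrass theorem, so the limit is unique. For other \<open>A\<close> or \<open>f\<close> the value is not
  meaningful.\<close>

definition fun_calc ::
    "(real \<Rightarrow> real) \<Rightarrow> ('a::complex_hilbert_space \<Rightarrow>\<^sub>L 'a) \<Rightarrow> ('a \<Rightarrow>\<^sub>L 'a)"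
  where "fun_calc f A = (THE T. \<forall>P :: nat \<Rightarrow> real poly.
    uniform_limit {t. complex_of_real t \<in> spectrum A} (\<lambda>n. poly (P n)) f sequentially \<longrightarrow>
    (\<lambda>n. op_poly (P n) A) \<longlonglongrightarrow> T)"

text \<open>On a strictly positive operator the spectrum lies in the open positive half-line, so both
  functions below are continuous on it.\<close>

definition op_powr ::
    "('a::complex_hilbert_space \<Rightarrow>\<^sub>L 'a) \<Rightarrow> real \<Rightarrow> ('a \<Rightarrow>\<^sub>L 'a)" (infixr "powr\<^sub>o\<^sub>p" 80)
  where "A powr\<^sub>o\<^sub>p r = fun_calc (\<lambda>t. t powr r) A"

definition op_ln :: "('a::complex_hilbert_space \<Rightarrow>\<^sub>L 'a) \<Rightarrow> ('a \<Rightarrow>\<^sub>L 'a)"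
  where "op_ln A = fun_calc ln A"

definition rel_op ::
    "('a::complex_hilbert_space \<Rightarrow>\<^sub>L 'a) \<Rightarrow> ('a \<Rightarrow>\<^sub>L 'a) \<Rightarrow> ('a \<Rightarrow>\<^sub>L 'a)"
  where "rel_op A B = A powr\<^sub>o\<^sub>p (- 1/2) o\<^sub>L B o\<^sub>L A powr\<^sub>o\<^sub>p (- 1/2)"

definition gen_rel_entropy ::
    "real \<Rightarrow> ('a::complex_hilbert_space \<Rightarrow>\<^sub>L 'a) \<Rightarrow> ('a \<Rightarrow>\<^sub>L 'a) \<Rightarrow> ('a \<Rightarrow>\<^sub>L 'a)"
  where "gen_rel_entropy r A B =
    A powr\<^sub>o\<^sub>p (1/2) o\<^sub>L rel_op A B powr\<^sub>o\<^sub>p r o\<^sub>L op_ln (rel_op A B) o\<^sub>L A powr\<^sub>o\<^sub>p (1/2)"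

definition tsallis_rel_entropy ::
    "real \<Rightarrow> ('a::complex_hilbert_space \<Rightarrow>\<^sub>L 'a) \<Rightarrow> ('a \<Rightarrow>\<^sub>L 'a) \<Rightarrow> ('a \<Rightarrow>\<^sub>L 'a)"
  where "tsallis_rel_entropy p A B =
    (1 / p) *\<^sub>R ((A powr\<^sub>o\<^sub>p (1/2) o\<^sub>L rel_op A B powr\<^sub>o\<^sub>p p o\<^sub>L A powr\<^sub>o\<^sub>p (1/2)) - A)"

end

theory Submission
  imports Defs "HOL-Computational_Algebra.Fundamental_Theorem_Algebra"
begin

text \<open>Write \<open>X = A\<^sup>-\<^sup>1\<^sup>/\<^sup>2 B A\<^sup>-\<^sup>1\<^sup>/\<^sup>2\<close>, whose spectrum lies in \<open>[u, v]\<close>. Conjugation by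
  \<open>A\<^sup>1\<^sup>/\<^sup>2\<close> turns \<open>g\<^sub>r(X)\<close> into \<open>T\<^sub>r(A|B) - S\<^sub>r(A|B) / 2\<close>, where
  \<open>g\<^sub>r(t) = (t\<^sup>r - 1) / r - t\<^sup>r ln t / 2\<close>, so by the functional calculus it suffices to compare
  \<open>g\<^sub>p\<close> and \<open>g\<^sub>q\<close> on \<open>[u, v]\<close>. With \<open>y = r ln t\<close>, the derivative of \<open>g\<^sub>r(t)\<close> in \<open>r\<close> is
  \<open>(e\<^sup>y (y - 1 - y\<^sup>2 / 2) + 1) / r\<^sup>2\<close>; the numerator vanishes at \<open>y = 0\<close> and has derivative
  \<open>- y\<^sup>2 e\<^sup>y / 2 \<le> 0\<close> in \<open>y\<close>, hence its sign is opposite to that of \<open>y\<close>.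

  The functional calculus rests on \<open>\<parallel>P(T)\<parallel> \<le> sup |P|\<close> over the spectrum of a self-adjoint
  \<open>T\<close>. One of \<open>\<plusminus>\<parallel>P(T)\<parallel>\<close> is in the spectrum of \<open>P(T)\<close>, and factoring \<open>P - \<lambda>\<close> into complex linear
  factors shows that every spectral value of \<open>P(T)\<close> is a value of \<open>P\<close> on the spectrum of \<open>T\<close>.\<close>

text \<open>Makes the operator space complete in norm, so that Cauchy sequences of polynomials of an
  operator converge.\<close>

instance complex_hilbert_space \<subseteq> banach ..

subsection \<open>Complex inner products\<close>

lemma cinner_add_left: "cinner (x + y) z = cinner x z + cinner y (z :: 'a::complex_inner)"
  by (metis cinner_add_right cinner_commute complex_cnj_add)

lemma cinner_scaleC_left: "cinner (c *\<^sub>C x) y = cnj c * cinner x (y :: 'a::complex_inner)"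
  by (metis cinner_commute cinner_scaleC_right complex_cnj_mult)

lemma cinner_scaleR_right: "cinner x (r *\<^sub>R y) = of_real r * cinner x (y :: 'a::complex_inner)"
  by (metis cinner_scaleC_right scaleC_of_real)

lemma cinner_scaleR_left: "cinner (r *\<^sub>R x) y = of_real r * cinner x (y :: 'a::complex_inner)"
  by (metis cinner_scaleC_left scaleC_of_real complex_cnj_complex_of_real)

lemma cinner_diff_right: "cinner x (y - z) = cinner x y - cinner x (z :: 'a::complex_inner)"
  using cinner_add_right[of x "y - z" z] by simp

lemma cinner_diff_left: "cinner (x - y) z = cinner x z - cinner y (z :: 'a::complex_inner)"
  using cinner_add_left[of "x - y" y z] by simp

lemma cinner_zero_right [simp]: "cinner x 0 = (0 :: complex)" for x :: "'a::complex_inner"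
  using cinner_add_right[of x 0 0] by simp

lemma Re_cinner_commute: "Re (cinner x y) = Re (cinner y (x :: 'a::complex_inner))"
  by (metis cinner_commute complex_cnj(1) complex_surj complex.sel(1))

lemma Re_cinner_self: "Re (cinner x x) = (norm (x :: 'a::complex_inner))\<^sup>2"
  by (simp add: cinner_self)

lemma norm_add_square:
  "(norm (x + y))\<^sup>2 = (norm x)\<^sup>2 + 2 * Re (cinner x y) + (norm (y :: 'a::complex_inner))\<^sup>2"
  using Re_cinner_self[of "x + y"] Re_cinner_commute[of x y]
  by (simp add: cinner_add_left cinner_add_right Re_cinner_self)

lemma norm_diff_square:
  "(norm (x - y))\<^sup>2 = (norm x)\<^sup>2 - 2 * Re (cinner x y) + (norm (y :: 'a::complex_inner))\<^sup>2"
  using norm_add_square[of "x - y" y]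
  by (simp add: cinner_diff_left Re_cinner_self)

text \<open>The triangle inequality for the norm is part of the class, so Cauchy-Schwarz for the
  real part follows from it by squaring and expanding.\<close>

lemma Re_cinner_le_norm: "Re (cinner x y) \<le> norm x * norm (y :: 'a::complex_inner)"
proof -
  have "(norm (x + y))\<^sup>2 \<le> (norm x + norm y)\<^sup>2"
    by (intro power_mono norm_triangle_ineq) simp
  then show ?thesis
    by (simp add: norm_add_square power2_sum)
qed

text \<open>Multiplying \<open>y\<close> by the conjugate phase of \<open>cinner x y\<close> turns
  the inner product into its modulus, which reduces the claim to the real part.\<close>

lemma cmod_cinner_le_norm: "cmod (cinner x y) \<le> norm x * norm (y :: 'a::complex_inner)"
proof -
  define z where "z = cinner x y"
  have "Re (cinner x (cnj (sgn z) *\<^sub>C y)) \<le> norm x * norm (cnj (sgn z) *\<^sub>C y)"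
    by (rule Re_cinner_le_norm)
  \<comment> \<open>An inequality rather than an equality, since \<open>sgn z\<close> is 0 when
    \<open>z\<close> is 0.\<close>
  also have "\<dots> \<le> norm x * norm y"
    by (intro mult_left_mono) (simp_all add: norm_scaleC norm_sgn)
  also have "cinner x (cnj (sgn z) *\<^sub>C y) = of_real (cmod z)"
    by (simp add: cinner_scaleC_right z_def[symmetric] sgn_eq mult.commute
        complex_norm_square[symmetric] power2_eq_square)
  finally show ?thesis
    by (simp add: z_def)
qed

lemma bounded_linear_cinner_right: "bounded_linear (cinner (x :: 'a::complex_inner))"
  by (rule bounded_linear_intro[where K = "norm x"])
    (simp_all add: cinner_add_right cinner_scaleR_right scaleR_conv_of_real
      cmod_cinner_le_norm mult.commute[of "norm _" "norm x"])

lemma scaleC_scaleR: "c *\<^sub>C (r *\<^sub>R x) = r *\<^sub>R (c *\<^sub>C (x :: 'a::complex_inner))"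
  by (simp add: linear_cmul bounded_linear.linear bounded_linear_scaleC)

lemma scaleC_diff_right: "c *\<^sub>C (x - y) = c *\<^sub>C x - c *\<^sub>C (y :: 'a::complex_inner)"
  by (simp add: linear_diff bounded_linear.linear bounded_linear_scaleC)

lemma scaleC_zero_right [simp]: "c *\<^sub>C 0 = (0 :: 'a::complex_inner)"
  by (simp add: linear_0 bounded_linear.linear bounded_linear_scaleC)

lemma scaleC_zero_left [simp]: "0 *\<^sub>C x = (0 :: 'a::complex_inner)"
  using scaleC_of_real[of 0 x] by simp

lemma scaleC_one [simp]: "1 *\<^sub>C x = (x :: 'a::complex_inner)"
  using scaleC_of_real[of 1 x] by simp

subsection \<open>Bounded, self-adjoint and invertible operators\<close>

lemma bounded_ops_apply: "T \<in> bounded_ops \<Longrightarrow> T (c *\<^sub>C x) = c *\<^sub>C T x"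
  by (simp add: bounded_ops_def)

lemma scalar_op_apply [simp]: "scalar_op c x = c *\<^sub>C x"
  by transfer simp

lemma scalar_op_one [simp]: "scalar_op 1 = (id_blinfun :: 'a::complex_hilbert_space \<Rightarrow>\<^sub>L 'a)"
  by (rule blinfun_eqI) simp

lemma scalar_op_zero [simp]: "scalar_op 0 = (0 :: 'a::complex_hilbert_space \<Rightarrow>\<^sub>L 'a)"
  by (rule blinfun_eqI) simp

lemma scalar_op_of_real:
  "scalar_op (of_real r) = r *\<^sub>R (id_blinfun :: 'a::complex_hilbert_space \<Rightarrow>\<^sub>L 'a)"
  by (rule blinfun_eqI) (simp add: scaleC_of_real blinfun.scaleR_left)

lemma scalar_op_in_bounded_ops [simp]: "scalar_op c \<in> bounded_ops"
  by (simp add: bounded_ops_def scaleC_scaleC mult.commute)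

lemma id_in_bounded_ops [simp]: "id_blinfun \<in> bounded_ops"
  by (simp add: bounded_ops_def)

lemma zero_in_bounded_ops [simp]: "0 \<in> bounded_ops"
  by (simp add: bounded_ops_def)

lemma bounded_ops_add: "S \<in> bounded_ops \<Longrightarrow> T \<in> bounded_ops \<Longrightarrow> S + T \<in> bounded_ops"
  by (simp add: bounded_ops_def blinfun.add_left scaleC_add_right)

lemma bounded_ops_diff: "S \<in> bounded_ops \<Longrightarrow> T \<in> bounded_ops \<Longrightarrow> S - T \<in> bounded_ops"
  by (simp add: bounded_ops_def blinfun.diff_left scaleC_diff_right)

lemma bounded_ops_scaleR: "T \<in> bounded_ops \<Longrightarrow> r *\<^sub>R T \<in> bounded_ops"
  by (simp add: bounded_ops_def blinfun.scaleR_left scaleC_scaleR)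

lemma bounded_ops_compose: "S \<in> bounded_ops \<Longrightarrow> T \<in> bounded_ops \<Longrightarrow> S o\<^sub>L T \<in> bounded_ops"
  by (simp add: bounded_ops_def)

lemma blinfun_apply_tendsto: "X \<longlonglongrightarrow> T \<Longrightarrow> (\<lambda>n. blinfun_apply (X n) x) \<longlonglongrightarrow> blinfun_apply T x"
  by (intro blinfun.tendsto tendsto_const)

lemma bounded_ops_closed:
  assumes "X \<longlonglongrightarrow> T" and "\<And>n. X n \<in> bounded_ops"
  shows "T \<in> bounded_ops"
  unfolding bounded_ops_def mem_Collect_eq
proof (intro allI)
  fix c x
  have "(\<lambda>n. X n (c *\<^sub>C x)) \<longlonglongrightarrow> T (c *\<^sub>C x)"
    using assms(1) by (rule blinfun_apply_tendsto)
  moreover have "(\<lambda>n. X n (c *\<^sub>C x)) \<longlonglongrightarrow> c *\<^sub>C T x"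
    using bounded_linear.tendsto[OF bounded_linear_scaleC blinfun_apply_tendsto[OF assms(1)]] assms(2)
    by (simp add: bounded_ops_apply)
  ultimately show "T (c *\<^sub>C x) = c *\<^sub>C T x"
    by (rule LIMSEQ_unique)
qed

lemma self_adjoint_bounded_ops: "self_adjoint_op T \<Longrightarrow> T \<in> bounded_ops"
  by (simp add: self_adjoint_op_def)

lemma self_adjoint_cinner: "self_adjoint_op T \<Longrightarrow> cinner (T x) y = cinner x (T y)"
  by (simp add: self_adjoint_op_def)

lemma self_adjoint_Im_cinner: "self_adjoint_op T \<Longrightarrow> Im (cinner x (T x)) = 0"
  by (metis cinner_commute self_adjoint_cinner Reals_cnj_iff complex_is_Real_iff)

lemma self_adjoint_id: "self_adjoint_op id_blinfun"
  by (simp add: self_adjoint_op_def)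

lemma self_adjoint_zero: "self_adjoint_op 0"
  by (simp add: self_adjoint_op_def) (metis cinner_commute cinner_zero_right complex_cnj_zero)

lemma self_adjoint_add: "self_adjoint_op S \<Longrightarrow> self_adjoint_op T \<Longrightarrow> self_adjoint_op (S + T)"
  by (simp add: self_adjoint_op_def bounded_ops_add blinfun.add_left cinner_add_left cinner_add_right)

lemma self_adjoint_scaleR: "self_adjoint_op T \<Longrightarrow> self_adjoint_op (r *\<^sub>R T)"
  by (simp add: self_adjoint_op_def bounded_ops_scaleR blinfun.scaleR_left
      cinner_scaleR_left cinner_scaleR_right)

lemma self_adjoint_compose_commute:
  "self_adjoint_op S \<Longrightarrow> self_adjoint_op T \<Longrightarrow> S o\<^sub>L T = T o\<^sub>L S \<Longrightarrow> self_adjoint_op (S o\<^sub>L T)"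
  unfolding self_adjoint_op_def
  by (metis blinfun_apply_blinfun_compose bounded_ops_compose)

lemma self_adjoint_conjugate:
  "self_adjoint_op S \<Longrightarrow> self_adjoint_op T \<Longrightarrow> self_adjoint_op (S o\<^sub>L T o\<^sub>L S)"
  by (simp add: self_adjoint_op_def bounded_ops_compose)

lemma self_adjoint_closed:
  assumes "X \<longlonglongrightarrow> T" and "\<And>n. self_adjoint_op (X n)"
  shows "self_adjoint_op T"
  unfolding self_adjoint_op_def
proof (intro conjI allI)
  show "T \<in> bounded_ops"
    using assms by (blast intro: bounded_ops_closed self_adjoint_bounded_ops)
  fix x y
  have "(\<lambda>n. cinner x (X n y)) \<longlonglongrightarrow> cinner x (T y)"
    by (intro bounded_linear.tendsto[OF bounded_linear_cinner_right] blinfun_apply_tendsto assms)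
  \<comment> \<open>Continuity is used only in the second argument; conjugation swaps the
    arguments.\<close>
  moreover have "(\<lambda>n. cnj (cinner y (X n x))) \<longlonglongrightarrow> cnj (cinner y (T x))"
    by (intro tendsto_cnj bounded_linear.tendsto[OF bounded_linear_cinner_right]
        blinfun_apply_tendsto assms)
  moreover have "cnj (cinner y (X n x)) = cinner x (X n y)" for n
    by (metis assms(2) cinner_commute self_adjoint_cinner)
  ultimately have "cinner x (T y) = cnj (cinner y (T x))"
    using LIMSEQ_unique by auto
  then show "cinner (T x) y = cinner x (T y)"
    by (metis cinner_commute)
qed

section \<open>Invertibility by composition and by coercivity\<close>

lemma blinfun_compose_eq_id_apply: "S o\<^sub>L T = id_blinfun \<Longrightarrow> S (T x) = x"
  by (simp flip: blinfun_apply_blinfun_compose)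

lemma invertible_op_compose:
  assumes "invertible_op S" and "invertible_op T"
  shows "invertible_op (S o\<^sub>L T)"
proof -
  obtain S' T' where *: "S' \<in> bounded_ops" "S o\<^sub>L S' = id_blinfun" "S' o\<^sub>L S = id_blinfun"
    "T' \<in> bounded_ops" "T o\<^sub>L T' = id_blinfun" "T' o\<^sub>L T = id_blinfun"
    using assms by (auto simp: invertible_op_def)
  show ?thesis
    unfolding invertible_op_def
    by (intro bexI[of _ "T' o\<^sub>L S'"] conjI blinfun_eqI)
      (simp_all add: bounded_ops_compose * blinfun_compose_eq_id_apply)
qed

lemma invertible_op_scalar_op: "c \<noteq> 0 \<Longrightarrow> invertible_op (scalar_op c)"
  unfolding invertible_op_def
  by (intro bexI[of _ "scalar_op (inverse c)"] conjI blinfun_eqI) (simp_all add: scaleC_scaleC)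

lemma invertible_op_bounded_below:
  assumes "invertible_op T"
  obtains K where "K > 0" and "\<And>x. norm x \<le> K * norm (T x)"
proof -
  obtain S where S: "S o\<^sub>L T = id_blinfun"
    using assms by (auto simp: invertible_op_def)
  \<comment> \<open>The summand 1 keeps the constant positive even on the zero space, where
    \<open>norm S\<close> is 0.\<close>
  have "norm x \<le> (norm S + 1) * norm (T x)" for x
  proof -
    have "S (T x) = x"
      using S by (rule blinfun_compose_eq_id_apply)
    then have "norm x \<le> norm S * norm (T x)"
      by (metis norm_blinfun)
    also have "\<dots> \<le> (norm S + 1) * norm (T x)"
      by (intro mult_right_mono) auto
    finally show ?thesis .
  qed
  then show ?thesis
    using that[of "norm S + 1"] by (simp add: add_nonneg_pos)
qed

text \<open>The Lax--Milgram argument: \<open>T x = y\<close> is solved by the fixed point of the contraction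
  \<open>x \<mapsto> x - s (T x - y)\<close> for small \<open>s > 0\<close>.\<close>

lemma coercive_imp_surj:
  fixes T :: "'a::complex_hilbert_space \<Rightarrow>\<^sub>L 'a"
  assumes "c > 0" and coercive: "\<And>x. c * (norm x)\<^sup>2 \<le> Re (cinner x (T x))"
  shows "\<exists>x. T x = y"
proof -
  \<comment> \<open>Adding \<open>c\<close> ensures both \<open>M > 0\<close> and
    \<open>c \<le> M\<close>, so that \<open>k\<close> below lies in \<open>[0, 1)\<close>.\<close>
  define M where "M = norm T + c"
  have M: "M > 0" "c \<le> M"
    using \<open>c > 0\<close> by (auto simp: M_def add_nonneg_pos)
  \<comment> \<open>This \<open>s\<close> minimises \<open>1 - 2 * s * c + s^2 * M^2\<close>, the
    bound on the factor by which squared distances shrink; the minimum is \<open>k\<close>.\<close>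
  define s where "s = c / M\<^sup>2"
  have s: "s > 0" using \<open>c > 0\<close> M by (simp add: s_def)
  define k where "k = 1 - c\<^sup>2 / M\<^sup>2"
  have k: "0 \<le> k" "k < 1"
    using \<open>c > 0\<close> M by (simp_all add: k_def field_simps power_mono)
  have contr: "(norm (x - s *\<^sub>R T x))\<^sup>2 \<le> k * (norm x)\<^sup>2" for x
  proof -
    have "norm (T x) \<le> M * norm x"
      using norm_blinfun[of T x] \<open>c > 0\<close> by (simp add: M_def distrib_right add_increasing2)
    then have "(norm (T x))\<^sup>2 \<le> (M * norm x)\<^sup>2"
      by (intro power_mono) simp_all
    then have 1: "s\<^sup>2 * (norm (T x))\<^sup>2 \<le> s\<^sup>2 * (M\<^sup>2 * (norm x)\<^sup>2)"
      by (intro mult_left_mono) (simp_all add: power_mult_distrib)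
    have 2: "s * (c * (norm x)\<^sup>2) \<le> s * Re (cinner x (T x))"
      using s coercive by (intro mult_left_mono) auto
    have 3: "s\<^sup>2 * M\<^sup>2 = s * c" and 4: "s * c = c\<^sup>2 / M\<^sup>2"
      using M by (simp_all add: s_def power2_eq_square field_simps)
    have "(norm (x - s *\<^sub>R T x))\<^sup>2 = (norm x)\<^sup>2 - 2 * (s * Re (cinner x (T x))) + s\<^sup>2 * (norm (T x))\<^sup>2"
      by (simp add: norm_diff_square cinner_scaleR_right power_mult_distrib)
    also have "\<dots> \<le> (norm x)\<^sup>2 - 2 * (s * (c * (norm x)\<^sup>2)) + (s\<^sup>2 * M\<^sup>2) * (norm x)\<^sup>2"
      using 1 2 by (simp add: mult.assoc)
    also have "\<dots> = k * (norm x)\<^sup>2"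
      unfolding 3 by (simp add: k_def 4[symmetric] algebra_simps)
    finally show ?thesis .
  qed
  \<comment> \<open>Since \<open>k\<close> bounds squared norms, the contraction constant is
    \<open>sqrt k\<close>.\<close>
  have "\<exists>!x. x - s *\<^sub>R (T x - y) = x"
  proof (rule banach_fix_type)
    show "0 \<le> sqrt k" "sqrt k < 1" using k by auto
    show "\<forall>x z. dist (x - s *\<^sub>R (T x - y)) (z - s *\<^sub>R (T z - y)) \<le> sqrt k * dist x z"
    proof (intro allI)
      fix x z
      have *: "x - s *\<^sub>R (T x - y) - (z - s *\<^sub>R (T z - y)) = (x - z) - s *\<^sub>R T (x - z)"
        by (simp add: blinfun.diff_right algebra_simps)
      have "norm ((x - z) - s *\<^sub>R T (x - z)) \<le> sqrt k * norm (x - z)"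
      proof (rule power2_le_imp_le)
        show "(norm ((x - z) - s *\<^sub>R T (x - z)))\<^sup>2 \<le> (sqrt k * norm (x - z))\<^sup>2"
          unfolding power_mult_distrib real_sqrt_pow2[OF k(1)] by (rule contr)
      qed (use k in simp)
      then show "dist (x - s *\<^sub>R (T x - y)) (z - s *\<^sub>R (T z - y)) \<le> sqrt k * dist x z"
        by (simp only: dist_norm *)
    qed
  qed
  then show ?thesis
    using s by auto
qed

text \<open>Coercivity bounds \<open>norm x\<close> by \<open>norm (T x) / c\<close>, which gives
  injectivity and a bounded inverse; surjectivity is \<open>coercive_imp_surj\<close>.\<close>

lemma coercive_imp_invertible_op:
  fixes T :: "'a::complex_hilbert_space \<Rightarrow>\<^sub>L 'a"
  assumes T: "T \<in> bounded_ops" and "c > 0"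
    and coercive: "\<And>x. c * (norm x)\<^sup>2 \<le> Re (cinner x (T x))"
  shows "invertible_op T"
proof -
  have below: "norm x \<le> norm (T x) * (1 / c)" for x
  proof (cases "x = 0")
    case False
    have "c * (norm x)\<^sup>2 \<le> norm x * norm (T x)"
      using coercive[of x] Re_cinner_le_norm[of x "T x"] by linarith
    with False \<open>c > 0\<close> show ?thesis
      by (simp add: power2_eq_square field_simps)
  qed simp
  have inj: "x = y" if "T x = T y" for x y
    using below[of "x - y"] that by (simp add: blinfun.diff_right)
  define S where "S = (\<lambda>y. SOME x. T x = y)"
  have TS: "T (S y) = y" for y
    unfolding S_def using coercive_imp_surj[OF \<open>c > 0\<close> coercive] by (rule someI_ex)
  \<comment> \<open>Additivity and homogeneity of \<open>S\<close> are checked after applying the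
    injective map \<open>T\<close> to both sides.\<close>
  have "bounded_linear S"
  proof (rule bounded_linear_intro[where K = "1 / c"])
    show "norm (S y) \<le> norm y * (1 / c)" for y
      using below[of "S y"] by (simp add: TS)
  qed (rule inj; simp add: TS blinfun.add_right blinfun.scaleR_right)+
  then have Blinfun_S: "Blinfun S x = S x" for x
    by (simp add: bounded_linear_Blinfun_apply)
  have ST: "S (T x) = x" for x
    by (rule inj) (rule TS)
  have "S (a *\<^sub>C x) = a *\<^sub>C S x" for a x
    by (rule inj) (simp add: TS bounded_ops_apply[OF T])
  then have "Blinfun S \<in> bounded_ops"
    by (simp add: bounded_ops_def Blinfun_S)
  moreover have "T o\<^sub>L Blinfun S = id_blinfun" "Blinfun S o\<^sub>L T = id_blinfun"
    by (intro blinfun_eqI; simp add: Blinfun_S TS ST)+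
  ultimately show ?thesis
    by (auto simp: invertible_op_def)
qed

text \<open>Coercivity of \<open>w T\<close> suffices. The factor \<open>w\<close> lets one
  criterion treat spectral parameters off the real axis and on either side of the numerical
  range.\<close>

lemma rotated_coercive_imp_invertible_op:
  fixes T :: "'a::complex_hilbert_space \<Rightarrow>\<^sub>L 'a"
  assumes T: "T \<in> bounded_ops" and "c > 0" and "w \<noteq> 0"
    and "\<And>x. c * (norm x)\<^sup>2 \<le> Re (w * cinner x (T x))"
  shows "invertible_op T"
proof -
  have "invertible_op (scalar_op w o\<^sub>L T)"
    using assms(4)
    by (intro coercive_imp_invertible_op[OF _ \<open>c > 0\<close>]) (simp_all add: bounded_ops_compose T cinner_scaleC_right)
  then have "invertible_op (scalar_op (inverse w) o\<^sub>L (scalar_op w o\<^sub>L T))"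
    using \<open>w \<noteq> 0\<close> by (simp add: invertible_op_compose invertible_op_scalar_op)
  also have "scalar_op (inverse w) o\<^sub>L (scalar_op w o\<^sub>L T) = T"
    using \<open>w \<noteq> 0\<close> by (intro blinfun_eqI) (simp add: scaleC_scaleC)
  finally show ?thesis .
qed

subsection \<open>The spectrum of a self-adjoint operator\<close>

abbreviation real_spectrum :: "('a::complex_hilbert_space \<Rightarrow>\<^sub>L 'a) \<Rightarrow> real set"
  where "real_spectrum T \<equiv> {t. complex_of_real t \<in> spectrum T}"

lemma cinner_minus_scalar_op:
  "cinner x ((T - scalar_op z) x) = cinner x (T x) - z * of_real ((norm (x :: 'a::complex_hilbert_space))\<^sup>2)"
  by (simp add: blinfun.diff_left cinner_diff_right cinner_scaleC_right cinner_self)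

lemma rotated_coercive_imp_not_in_spectrum:
  fixes T :: "'a::complex_hilbert_space \<Rightarrow>\<^sub>L 'a"
  assumes "self_adjoint_op T" and "c > 0" and "w \<noteq> 0"
    and "\<And>x. c * (norm x)\<^sup>2 \<le> Re (w * (cinner x (T x) - z * of_real ((norm x)\<^sup>2)))"
  shows "z \<notin> spectrum T"
  unfolding spectrum_def mem_Collect_eq not_not
  using rotated_coercive_imp_invertible_op[OF _ assms(2,3), of "T - scalar_op z"] assms(1,4)
  by (simp add: bounded_ops_diff self_adjoint_bounded_ops cinner_minus_scalar_op)

lemma self_adjoint_spectrum_real:
  fixes T :: "'a::complex_hilbert_space \<Rightarrow>\<^sub>L 'a"
  assumes "self_adjoint_op T" and "z \<in> spectrum T"
  shows "z \<in> \<real>"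
proof (rule ccontr)
  assume "z \<notin> \<real>"
  then have "Im z \<noteq> 0"
    by (simp add: complex_is_Real_iff)
  \<comment> \<open>Since \<open>cinner x (T x)\<close> is real, multiplying by
    \<open>\<i> * Im z\<close> removes it from the real part and leaves exactly
    \<open>(Im z)^2 * (norm x)^2\<close>.\<close>
  then have "z \<notin> spectrum T"
    using self_adjoint_Im_cinner[OF assms(1)]
    by (intro rotated_coercive_imp_not_in_spectrum[OF assms(1), where c = "(Im z)\<^sup>2" and w = "\<i> * Im z"])
      (simp_all, simp add: power2_eq_square)
  with assms(2) show False by simp
qed

text \<open>For \<open>t < m\<close> the operator \<open>T - t\<close> is coercive with constant
  \<open>m - t\<close>; the upper bound is the mirror image with \<open>w = -1\<close>.\<close>

lemma real_spectrum_lower: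
  fixes T :: "'a::complex_hilbert_space \<Rightarrow>\<^sub>L 'a"
  assumes "self_adjoint_op T" and "\<And>x. m * (norm x)\<^sup>2 \<le> Re (cinner x (T x))"
    and "t \<in> real_spectrum T"
  shows "m \<le> t"
proof (rule ccontr)
  assume "\<not> m \<le> t"
  then have "of_real t \<notin> spectrum T"
    using assms(2)
    by (intro rotated_coercive_imp_not_in_spectrum[OF assms(1), where c = "m - t" and w = 1])
      (auto simp: algebra_simps)
  with assms(3) show False by simp
qed

lemma real_spectrum_upper:
  fixes T :: "'a::complex_hilbert_space \<Rightarrow>\<^sub>L 'a"
  assumes "self_adjoint_op T" and "\<And>x. Re (cinner x (T x)) \<le> M * (norm x)\<^sup>2"
    and "t \<in> real_spectrum T"
  shows "t \<le> M"
proof (rule ccontr)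
  assume "\<not> t \<le> M"
  then have "of_real t \<notin> spectrum T"
    using assms(2)
    by (intro rotated_coercive_imp_not_in_spectrum[OF assms(1), where c = "t - M" and w = "-1"])
      (auto simp: algebra_simps)
  with assms(3) show False by simp
qed

text \<open>Vectors almost attaining \<open>\<parallel>T\<parallel>\<close> show that \<open>T\<^sup>2 - \<parallel>T\<parallel>\<^sup>2 = (T - \<parallel>T\<parallel>) (T + \<parallel>T\<parallel>)\<close>
  is not bounded below.\<close>

lemma self_adjoint_norm_in_spectrum:
  fixes T :: "'a::complex_hilbert_space \<Rightarrow>\<^sub>L 'a"
  assumes T: "self_adjoint_op T" and nontrivial: "\<exists>x :: 'a. x \<noteq> 0"
  obtains l where "\<bar>l\<bar> = norm T" and "l \<in> real_spectrum T"
proof -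
  define M where "M = norm T"
  define R where "R = (T - scalar_op (of_real M)) o\<^sub>L (T - scalar_op (of_real (- M)))"
  have "\<not> invertible_op R"
  proof
    assume "invertible_op R"
    then obtain K where K: "K > 0" "\<And>x. norm x \<le> K * norm (R x)"
      by (rule invertible_op_bounded_below) blast
    have R: "R x = T (T x) - M\<^sup>2 *\<^sub>R x" for x
      by (simp only: R_def scalar_op_of_real)
        (simp add: blinfun.bilinear_simps power2_eq_square algebra_simps)
    \<comment> \<open>Expand the square of \<open>norm (R x)\<close>, bound
      \<open>norm (T (T x))\<close> by \<open>M * norm (T x)\<close>, and compare with the lower
      bound by \<open>K\<close>.\<close>
    have main: "(norm x)\<^sup>2 \<le> K\<^sup>2 * M\<^sup>2 * (M\<^sup>2 * (norm x)\<^sup>2 - (norm (T x))\<^sup>2)" for x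
    proof -
      have "(norm (T (T x)))\<^sup>2 \<le> (M * norm (T x))\<^sup>2"
        unfolding M_def by (intro power_mono norm_blinfun) simp
      moreover have "Re (cinner (T (T x)) x) = (norm (T x))\<^sup>2"
        by (simp add: self_adjoint_cinner[OF T] Re_cinner_self[symmetric])
      ultimately have "(norm (R x))\<^sup>2 \<le> M\<^sup>2 * (M\<^sup>2 * (norm x)\<^sup>2 - (norm (T x))\<^sup>2)"
        unfolding R norm_diff_square cinner_scaleR_right
        by (simp add: power_mult_distrib) (simp add: power2_eq_square power4_eq_xxxx algebra_simps)
      then have "K\<^sup>2 * (norm (R x))\<^sup>2 \<le> K\<^sup>2 * (M\<^sup>2 * (M\<^sup>2 * (norm x)\<^sup>2 - (norm (T x))\<^sup>2))"
        by (intro mult_left_mono) auto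
      moreover have "(norm x)\<^sup>2 \<le> (K * norm (R x))\<^sup>2"
        using K by (intro power_mono) auto
      ultimately show ?thesis
        by (simp add: power_mult_distrib mult.assoc)
    qed
    \<comment> \<open>A nonzero vector rules out \<open>L = 0\<close> and forces
      \<open>M^2 - 1 / L\<close> to be nonnegative.\<close>
    obtain e :: 'a where e: "e \<noteq> 0" using nontrivial by blast
    define L where "L = K\<^sup>2 * M\<^sup>2"
    have "L \<noteq> 0"
      using main[of e] e by (auto simp: L_def)
    then have "L > 0" by (simp add: L_def)
    \<comment> \<open>Solving \<open>main\<close> for \<open>norm (T x)\<close> yields a bound on
      \<open>T\<close> strictly smaller than its norm.\<close>
    have Tx: "(norm (T x))\<^sup>2 \<le> (M\<^sup>2 - 1 / L) * (norm x)\<^sup>2" for x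
      using main[of x] \<open>L > 0\<close> by (simp add: L_def[symmetric] field_simps)
    have nonneg: "0 \<le> M\<^sup>2 - 1 / L"
      using Tx[of e] e by (smt (verit) mult_nonneg_nonpos mult_neg_pos zero_le_power2 zero_less_power2 norm_eq_zero)
    have "norm T \<le> sqrt (M\<^sup>2 - 1 / L)"
    proof (rule norm_blinfun_bound)
      show "norm (T x) \<le> sqrt (M\<^sup>2 - 1 / L) * norm x" for x
        using Tx[of x] nonneg by (intro power2_le_imp_le[of "norm (T x)"]) (simp_all add: power_mult_distrib)
    qed (use nonneg in simp)
    then have "M\<^sup>2 \<le> M\<^sup>2 - 1 / L"
      using nonneg power_mono[of M "sqrt (M\<^sup>2 - 1 / L)" 2] by (simp add: M_def)
    with \<open>L > 0\<close> show False by simp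
  qed
  then have "of_real M \<in> spectrum T \<or> of_real (- M) \<in> spectrum T"
    unfolding R_def spectrum_def using invertible_op_compose by blast
  then show ?thesis
    using that[of M] that[of "- M"] by (auto simp: M_def)
qed

subsection \<open>Polynomials of an operator\<close>

lemma blinfun_compose_simps:
  "(S + T) o\<^sub>L U = (S o\<^sub>L U) + (T o\<^sub>L U)" "U o\<^sub>L (S + T) = (U o\<^sub>L S) + (U o\<^sub>L T)"
  "(S - T) o\<^sub>L U = (S o\<^sub>L U) - (T o\<^sub>L U)" "U o\<^sub>L (S - T) = (U o\<^sub>L S) - (U o\<^sub>L T)"
  "(r *\<^sub>R S) o\<^sub>L U = r *\<^sub>R (S o\<^sub>L U)" "U o\<^sub>L (r *\<^sub>R S) = r *\<^sub>R (U o\<^sub>L S)"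
  "id_blinfun o\<^sub>L S = S" "S o\<^sub>L id_blinfun = S"
  "(S o\<^sub>L T) o\<^sub>L U = S o\<^sub>L (T o\<^sub>L U)"
  for r :: real
  by (intro blinfun_eqI; simp add: blinfun.bilinear_simps)+

text \<open>Complex coefficients accommodate the complex roots in the factorisation of a real
  polynomial. The Horner form matches induction on \<open>pCons\<close>.\<close>

definition complex_op_poly ::
    "complex poly \<Rightarrow> ('a::complex_hilbert_space \<Rightarrow>\<^sub>L 'a) \<Rightarrow> ('a \<Rightarrow>\<^sub>L 'a)"
  where "complex_op_poly P T = fold_coeffs (\<lambda>a S. scalar_op a + (T o\<^sub>L S)) P 0"

lemma complex_op_poly_0 [simp]: "complex_op_poly 0 T = 0"
  by (simp add: complex_op_poly_def)

lemma complex_op_poly_pCons [simp]: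
  "complex_op_poly (pCons a P) T = scalar_op a + (T o\<^sub>L complex_op_poly P T)"
  by (cases "P = 0 \<and> a = 0") (auto simp: complex_op_poly_def)

lemma scalar_op_add: "scalar_op (a + b) = scalar_op a + scalar_op b"
  by (rule blinfun_eqI) (simp add: blinfun.add_left scaleC_add_left)

lemma complex_op_poly_add:
  "complex_op_poly (P + Q) T = complex_op_poly P T + complex_op_poly Q T"
  by (induction P Q rule: poly_induct2)
    (simp_all add: scalar_op_add blinfun_compose_simps)

lemma complex_op_poly_smult:
  assumes "T \<in> bounded_ops"
  shows "complex_op_poly (smult a P) T = scalar_op a o\<^sub>L complex_op_poly P T"
  using assms
  by (induction P)
    (auto intro!: blinfun_eqI simp: blinfun.bilinear_simps scaleC_add_right scaleC_scaleC bounded_ops_apply)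

lemma complex_op_poly_mult:
  assumes "T \<in> bounded_ops"
  shows "complex_op_poly (P * Q) T = complex_op_poly P T o\<^sub>L complex_op_poly Q T"
  by (induction P)
    (simp_all add: complex_op_poly_add complex_op_poly_smult assms blinfun_compose_simps)

text \<open>Padding with zero coefficients handles \<open>pCons a 0\<close>, whose degree is 0
  rather than a successor.\<close>

lemma op_poly_eq_sum: "degree P \<le> n \<Longrightarrow> op_poly P T = (\<Sum>i\<le>n. coeff P i *\<^sub>R op_power T i)"
  unfolding op_poly_def by (rule sum.mono_neutral_left) (auto simp: coeff_eq_0)

lemma op_poly_0 [simp]: "op_poly 0 T = 0"
  by (simp add: op_poly_def)

lemma op_poly_pCons [simp]: "op_poly (pCons a P) T = a *\<^sub>R id_blinfun + (T o\<^sub>L op_poly P T)"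
proof -
  have "op_poly (pCons a P) T = (\<Sum>i\<le>Suc (degree P). coeff (pCons a P) i *\<^sub>R op_power T i)"
    by (rule op_poly_eq_sum) (rule degree_pCons_le)
  also have "\<dots> = a *\<^sub>R id_blinfun + (\<Sum>i\<le>degree P. coeff P i *\<^sub>R (T o\<^sub>L op_power T i))"
    by (subst sum.atMost_Suc_shift) simp
  also have "(\<Sum>i\<le>degree P. coeff P i *\<^sub>R (T o\<^sub>L op_power T i)) = T o\<^sub>L op_poly P T"
    unfolding op_poly_def
    by (simp add: bounded_bilinear.sum_right[OF bounded_bilinear_blinfun_compose] blinfun_compose_simps)
  finally show ?thesis .
qed

lemma op_poly_add: "op_poly (P + Q) T = op_poly P T + op_poly Q T"
  by (induction P Q rule: poly_induct2) (simp_all add: scaleR_left_distrib blinfun_compose_simps)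

lemma op_poly_smult: "op_poly (smult a P) T = a *\<^sub>R op_poly P T"
  by (induction P) (simp_all add: scaleR_right_distrib blinfun_compose_simps)

lemma op_poly_diff: "op_poly (P - Q) T = op_poly P T - op_poly Q T"
  using op_poly_add[of "P - Q" Q T] by simp

lemma op_poly_mult: "op_poly (P * Q) T = op_poly P T o\<^sub>L op_poly Q T"
  by (induction P) (simp_all add: op_poly_add op_poly_smult blinfun_compose_simps)

lemma complex_op_poly_of_real: "complex_op_poly (map_poly of_real P) T = op_poly P T"
  by (induction P) (simp_all add: map_poly_pCons scalar_op_of_real)

lemma self_adjoint_op_poly:
  assumes T: "self_adjoint_op T"
  shows "self_adjoint_op (op_poly P T)"
proof (induction P)
  case (pCons a P)
  \<comment> \<open>\<open>T\<close> commutes with its polynomials because \<open>[:0, 1:]\<close>,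
    which represents \<open>T\<close>, commutes with \<open>P\<close>.\<close>
  have "T o\<^sub>L op_poly P T = op_poly ([:0, 1:] * P) T"
    by (simp add: op_poly_mult blinfun_compose_simps)
  also have "\<dots> = op_poly P T o\<^sub>L T"
    by (subst mult.commute, subst op_poly_mult) (simp add: blinfun_compose_simps)
  finally show ?case
    using pCons T
    by (simp add: self_adjoint_add self_adjoint_scaleR self_adjoint_id self_adjoint_compose_commute)
qed (simp add: self_adjoint_zero)

text \<open>The half of the spectral mapping theorem that is needed: each root \<open>z\<close> of
  \<open>P\<close> lies outside the spectrum, so every linear factor \<open>T - z\<close> is
  invertible, and so is their product.\<close>

lemma complex_op_poly_invertible:
  fixes T :: "'a::complex_hilbert_space \<Rightarrow>\<^sub>L 'a"
  assumes T: "T \<in> bounded_ops" and "P \<noteq> 0" and "\<And>z. z \<in> spectrum T \<Longrightarrow> poly P z \<noteq> 0"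
  shows "invertible_op (complex_op_poly P T)"
  using assms(2,3)
proof (induction "degree P" arbitrary: P)
  case 0
  then obtain c where "P = [:c:]" "c \<noteq> 0"
    by (metis degree_eq_zeroE pCons_eq_0_iff)
  then show ?case
    by (simp add: invertible_op_scalar_op)
next
  case (Suc n)
  have "\<not> constant (poly P)"
    using Suc.hyps(2) by (simp add: constant_degree)
  then obtain z where z: "poly P z = 0"
    using fundamental_theorem_of_algebra by blast
  then obtain Q where Q: "P = [:- z, 1:] * Q"
    by (auto simp: poly_eq_0_iff_dvd)
  have "Q \<noteq> 0"
    using Q Suc.prems(1) by auto
  then have "degree P = Suc (degree Q)"
    unfolding Q by (subst degree_mult_eq) auto
  then have "n = degree Q"
    using Suc.hyps(2) by simp
  moreover have "poly Q y \<noteq> 0" if "y \<in> spectrum T" for y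
    using Suc.prems(2)[OF that] by (simp add: Q)
  ultimately have "invertible_op (complex_op_poly Q T)"
    using Suc.hyps(1) \<open>Q \<noteq> 0\<close> by blast
  moreover have "invertible_op (T - scalar_op z)"
    using z Suc.prems(2) by (auto simp: spectrum_def)
  moreover have "complex_op_poly [:- z, 1:] T = T - scalar_op z"
    using scalar_op_add[of "- z" z]
    by (simp add: blinfun_compose_simps eq_neg_iff_add_eq_0)
  ultimately show ?case
    unfolding Q complex_op_poly_mult[OF T] by (simp add: invertible_op_compose)
qed

lemma norm_op_poly_le:
  fixes T :: "'a::complex_hilbert_space \<Rightarrow>\<^sub>L 'a"
  assumes T: "self_adjoint_op T" and "e \<ge> 0"
    and bound: "\<And>t. t \<in> real_spectrum T \<Longrightarrow> \<bar>poly P t\<bar> \<le> e"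
  shows "norm (op_poly P T) \<le> e"
proof (cases "\<exists>x :: 'a. x \<noteq> 0")
  \<comment> \<open>On the zero space the spectrum is empty and \<open>bound\<close> is vacuous, so
    \<open>e \<ge> 0\<close> settles the case.\<close>
  case False
  then have "op_poly P T = 0"
    by (intro blinfun_eqI) simp
  with \<open>e \<ge> 0\<close> show ?thesis by simp
next
  case True
  obtain l where l: "\<bar>l\<bar> = norm (op_poly P T)" "l \<in> real_spectrum (op_poly P T)"
    using self_adjoint_norm_in_spectrum[OF self_adjoint_op_poly[OF T] True] by blast
  define Q where "Q = P - [:l:]"
  have "complex_op_poly (map_poly of_real Q) T = op_poly P T - scalar_op (of_real l)"
    unfolding complex_op_poly_of_real Q_def op_poly_diff
    by (simp add: scalar_op_of_real)
  then have not_inv: "\<not> invertible_op (complex_op_poly (map_poly of_real Q) T)"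
    using l(2) by (simp add: spectrum_def)
  have "\<exists>t \<in> real_spectrum T. poly P t = l"
  proof (cases "Q = 0")
    \<comment> \<open>Here \<open>P\<close> is constant, and it is enough that the spectrum of
      \<open>T\<close> is nonempty.\<close>
    case True
    obtain t where "t \<in> real_spectrum T"
      using self_adjoint_norm_in_spectrum[OF T \<open>\<exists>x. x \<noteq> 0\<close>] by blast
    moreover have "P = [:l:]" using True by (simp add: Q_def)
    ultimately show ?thesis by auto
  next
    case False
    then have "map_poly complex_of_real Q \<noteq> 0"
      by (simp add: map_poly_eq_0_iff)
    then obtain z where z: "z \<in> spectrum T" "poly (map_poly complex_of_real Q) z = 0"
      using complex_op_poly_invertible[OF self_adjoint_bounded_ops[OF T]] not_inv by blast
    then obtain t where "z = of_real t"
      using self_adjoint_spectrum_real[OF T] by (auto elim: Reals_cases)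
    moreover have "poly (map_poly complex_of_real Q) (of_real t) = of_real (poly Q t)"
      by (induction Q) (simp_all add: map_poly_pCons)
    ultimately show ?thesis
      using z by (auto simp: Q_def)
  qed
  then show ?thesis
    using bound l(1) by fastforce
qed

subsection \<open>Continuous functional calculus\<close>

text \<open>Weierstrass approximation with tolerance \<open>1 / (n + 1)\<close> at index
  \<open>n\<close>, in the sequential form used by \<open>fun_calc\<close>.\<close>

lemma continuous_on_imp_poly_uniform_limit:
  fixes f :: "real \<Rightarrow> real"
  assumes "continuous_on {a..b} f"
  obtains P where "uniform_limit {a..b} (\<lambda>n. poly (P n)) f sequentially"
proof -
  have "\<exists>P. \<forall>t\<in>{a..b}. \<bar>f t - poly P t\<bar> < inverse (real (Suc n))" for n
  proof -
    obtain g where g: "real_polynomial_function g"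
      "\<And>t. t \<in> {a..b} \<Longrightarrow> \<bar>f t - g t\<bar> < inverse (real (Suc n))"
      using Stone_Weierstrass_real_polynomial_function[OF compact_Icc assms, of "inverse (real (Suc n))"]
      by auto
    then obtain c k where "g = (\<lambda>t. \<Sum>i\<le>k. c i * t ^ i)"
      using real_polynomial_function_iff_sum by auto
    then have "g t = poly (\<Sum>i\<le>k. monom (c i) i) t" for t
      by (simp add: poly_sum poly_monom)
    with g show ?thesis by metis
  qed
  then obtain P where P: "\<And>n t. t \<in> {a..b} \<Longrightarrow> \<bar>f t - poly (P n) t\<bar> < inverse (real (Suc n))"
    by metis
  have "uniform_limit {a..b} (\<lambda>n. poly (P n)) f sequentially"
  proof (rule uniform_limitI)
    fix e :: real assume "e > 0"
    then have "\<forall>\<^sub>F n in sequentially. inverse (real (Suc n)) < e"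
      using LIMSEQ_inverse_real_of_nat by (simp add: order_tendstoD)
    then show "\<forall>\<^sub>F n in sequentially. \<forall>t\<in>{a..b}. dist (poly (P n) t) (f t) < e"
    proof eventually_elim
      case (elim n)
      then show ?case
        using P[of _ n] less_trans by (simp only: dist_real_def abs_minus_commute[of "poly _ _"]) blast
    qed
  qed
  then show ?thesis using that by blast
qed

text \<open>A compact interval around the spectrum makes Weierstrass approximation and boundedness
  of continuous functions directly available.\<close>

locale spectral_interval =
  fixes T :: "'a::complex_hilbert_space \<Rightarrow>\<^sub>L 'a" and a b :: real
  assumes self_adjoint: "self_adjoint_op T"
    and spectrum_subset: "real_spectrum T \<subseteq> {a..b}"
begin

lemma poly_approx:
  assumes "continuous_on {a..b} f"
  obtains P where "uniform_limit (real_spectrum T) (\<lambda>n. poly (P n)) f sequentially"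
  using continuous_on_imp_poly_uniform_limit[OF assms] uniform_limit_on_subset[OF _ spectrum_subset]
  by metis

text \<open>By \<open>norm_op_poly_le\<close>, uniform closeness on the spectrum becomes closeness
  in operator norm.\<close>

lemma op_poly_Cauchy:
  assumes "uniform_limit (real_spectrum T) (\<lambda>n. poly (P n)) f sequentially"
  shows "Cauchy (\<lambda>n. op_poly (P n) T)"
proof (rule metric_CauchyI)
  fix e :: real assume "e > 0"
  \<comment> \<open>Two errors of \<open>e / 4\<close> give a norm bound of \<open>e / 2\<close>,
    which turns the weak inequality of \<open>norm_op_poly_le\<close> into a strict one below
    \<open>e\<close>.\<close>
  then have "\<forall>\<^sub>F n in sequentially. \<forall>t\<in>real_spectrum T. dist (poly (P n) t) (f t) < e / 4"
    using uniform_limitD[OF assms, of "e / 4"] by simp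
  then obtain N where N: "\<And>n t. n \<ge> N \<Longrightarrow> t \<in> real_spectrum T \<Longrightarrow> dist (poly (P n) t) (f t) < e / 4"
    unfolding eventually_sequentially by blast
  have "dist (op_poly (P m) T) (op_poly (P n) T) < e" if "m \<ge> N" "n \<ge> N" for m n
  proof -
    have "norm (op_poly (P m - P n) T) \<le> e / 2"
    proof (rule norm_op_poly_le[OF self_adjoint])
      fix t assume "t \<in> real_spectrum T"
      then show "\<bar>poly (P m - P n) t\<bar> \<le> e / 2"
        using dist_triangle_half_r[of "f t" "poly (P m) t" "e / 2" "poly (P n) t"] N[of m t] N[of n t] that
        by (simp add: dist_commute dist_real_def)
    qed (use \<open>e > 0\<close> in simp)
    then show ?thesis
      using \<open>e > 0\<close> by (simp add: dist_norm op_poly_diff)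
  qed
  then show "\<exists>N. \<forall>m\<ge>N. \<forall>n\<ge>N. dist (op_poly (P m) T) (op_poly (P n) T) < e"
    by blast
qed

text \<open>Makes the limit defining \<open>fun_calc\<close> independent of the approximating
  sequence.\<close>

lemma op_poly_diff_tendsto_0:
  assumes "uniform_limit (real_spectrum T) (\<lambda>n. poly (P n)) f sequentially"
    and "uniform_limit (real_spectrum T) (\<lambda>n. poly (Q n)) f sequentially"
  shows "(\<lambda>n. op_poly (P n) T - op_poly (Q n) T) \<longlonglongrightarrow> 0"
proof (rule metric_LIMSEQ_I)
  fix e :: real assume "e > 0"
  have "uniform_limit (real_spectrum T) (\<lambda>n t. poly (P n) t - poly (Q n) t) (\<lambda>t. f t - f t) sequentially"
    by (intro uniform_limit_minus assms)
  then have "\<forall>\<^sub>F n in sequentially. \<forall>t\<in>real_spectrum T. dist (poly (P n) t - poly (Q n) t) (f t - f t) < e / 2"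
    using \<open>e > 0\<close> by (intro uniform_limitD) auto
  then obtain N where
    N: "\<And>n t. n \<ge> N \<Longrightarrow> t \<in> real_spectrum T \<Longrightarrow> dist (poly (P n) t - poly (Q n) t) (f t - f t) < e / 2"
    unfolding eventually_sequentially by blast
  have "norm (op_poly (P n - Q n) T) \<le> e / 2" if "n \<ge> N" for n
    using N[OF that] \<open>e > 0\<close> by (intro norm_op_poly_le[OF self_adjoint]) force+
  then show "\<exists>N. \<forall>n\<ge>N. dist (op_poly (P n) T - op_poly (Q n) T) 0 < e"
    using \<open>e > 0\<close> by (fastforce simp: op_poly_diff)
qed

lemma fun_calc_tendsto:
  assumes f: "continuous_on {a..b} f"
    and P: "uniform_limit (real_spectrum T) (\<lambda>n. poly (P n)) f sequentially"
  shows "(\<lambda>n. op_poly (P n) T) \<longlonglongrightarrow> fun_calc f T"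
proof -
  obtain S where S: "(\<lambda>n. op_poly (P n) T) \<longlonglongrightarrow> S"
    using op_poly_Cauchy[OF P] by (auto simp: Cauchy_convergent_iff convergent_def)
  have lim: "(\<lambda>n. op_poly (Q n) T) \<longlonglongrightarrow> S"
    if "uniform_limit (real_spectrum T) (\<lambda>n. poly (Q n)) f sequentially" for Q
    using tendsto_add[OF op_poly_diff_tendsto_0[OF that P] S] by simp
  have "fun_calc f T = S"
    \<comment> \<open>Uniqueness uses the sequence \<open>P\<close>: every candidate must be the
      limit along it.\<close>
    unfolding fun_calc_def
    by (rule the_equality) (use lim P S LIMSEQ_unique in blast)+
  with S show ?thesis by simp
qed

section \<open>Algebraic and order properties of the functional calculus\<close>

lemma fun_calc_poly: "fun_calc (poly P) T = op_poly P T"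
  using fun_calc_tendsto[of "poly P" "\<lambda>_. P"]
  by (simp add: uniform_limit_const continuous_on_poly LIMSEQ_const_iff)

lemma fun_calc_const: "fun_calc (\<lambda>_. c) T = c *\<^sub>R id_blinfun"
proof -
  have "poly [:c:] = (\<lambda>_. c)"
    by (rule ext) simp
  then show ?thesis
    using fun_calc_poly[of "[:c:]"] by simp
qed

lemma fun_calc_ident: "fun_calc (\<lambda>t. t) T = T"
proof -
  have "poly [:0, 1:] = (\<lambda>t :: real. t)"
    by (rule ext) simp
  then show ?thesis
    using fun_calc_poly[of "[:0, 1:]"] by (simp add: blinfun_compose_simps)
qed

text \<open>The defining property sees a function only through its values on the spectrum.\<close>

lemma fun_calc_cong:
  assumes "\<And>t. t \<in> {a..b} \<Longrightarrow> f t = g t"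
  shows "fun_calc f T = fun_calc g T"
proof -
  have "uniform_limit (real_spectrum T) F f sequentially \<longleftrightarrow> uniform_limit (real_spectrum T) F g sequentially" for F
    using assms spectrum_subset by (intro uniform_limit_cong') auto
  then show ?thesis
    by (simp only: fun_calc_def)
qed

lemma fun_calc_add:
  assumes f: "continuous_on {a..b} f" and g: "continuous_on {a..b} g"
  shows "fun_calc (\<lambda>t. f t + g t) T = fun_calc f T + fun_calc g T"
proof -
  obtain P Q where P: "uniform_limit (real_spectrum T) (\<lambda>n. poly (P n)) f sequentially"
    and Q: "uniform_limit (real_spectrum T) (\<lambda>n. poly (Q n)) g sequentially"
    using poly_approx[OF f] poly_approx[OF g] by metis
  have "(\<lambda>n. op_poly (P n + Q n) T) \<longlonglongrightarrow> fun_calc (\<lambda>t. f t + g t) T"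
    using uniform_limit_add[OF P Q]
    by (intro fun_calc_tendsto continuous_on_add f g) (simp add: poly_add[abs_def])
  moreover have "(\<lambda>n. op_poly (P n + Q n) T) \<longlonglongrightarrow> fun_calc f T + fun_calc g T"
    unfolding op_poly_add by (intro tendsto_add fun_calc_tendsto f g P Q)
  ultimately show ?thesis by (rule LIMSEQ_unique)
qed

lemma fun_calc_mult:
  assumes f: "continuous_on {a..b} f" and g: "continuous_on {a..b} g"
  shows "fun_calc (\<lambda>t. f t * g t) T = fun_calc f T o\<^sub>L fun_calc g T"
proof -
  obtain P Q where P: "uniform_limit (real_spectrum T) (\<lambda>n. poly (P n)) f sequentially"
    and Q: "uniform_limit (real_spectrum T) (\<lambda>n. poly (Q n)) g sequentially"
    using poly_approx[OF f] poly_approx[OF g] by metis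
  \<comment> \<open>Products of uniform limits converge uniformly when the limit functions are
    bounded.\<close>
  have bounded: "bounded (h ` real_spectrum T)" if "continuous_on {a..b} h" for h :: "real \<Rightarrow> real"
    using compact_imp_bounded[OF compact_continuous_image[OF that compact_Icc]]
    by (rule bounded_subset) (use spectrum_subset in blast)
  have "(\<lambda>n. op_poly (P n * Q n) T) \<longlonglongrightarrow> fun_calc (\<lambda>t. f t * g t) T"
    using uniform_lim_mult[OF P Q bounded[OF f] bounded[OF g]]
    by (intro fun_calc_tendsto continuous_on_mult f g) (simp add: poly_mult[abs_def])
  moreover have "(\<lambda>n. op_poly (P n * Q n) T) \<longlonglongrightarrow> (fun_calc f T o\<^sub>L fun_calc g T)"
    unfolding op_poly_mult
    by (intro bounded_bilinear.tendsto[OF bounded_bilinear_blinfun_compose] fun_calc_tendsto f g P Q)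
  ultimately show ?thesis by (rule LIMSEQ_unique)
qed

lemma fun_calc_scale:
  assumes "continuous_on {a..b} f"
  shows "fun_calc (\<lambda>t. c * f t) T = c *\<^sub>R fun_calc f T"
  using fun_calc_mult[OF continuous_on_const assms]
  by (simp add: fun_calc_const blinfun_compose_simps)

lemma fun_calc_diff:
  assumes f: "continuous_on {a..b} f" and g: "continuous_on {a..b} g"
  shows "fun_calc (\<lambda>t. f t - g t) T = fun_calc f T - fun_calc g T"
  using fun_calc_add[OF continuous_on_diff[OF f g] g] by simp

lemma fun_calc_self_adjoint:
  assumes "continuous_on {a..b} f"
  shows "self_adjoint_op (fun_calc f T)"
  using poly_approx[OF assms] fun_calc_tendsto[OF assms]
  by (metis self_adjoint_closed self_adjoint_op_poly[OF self_adjoint])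

text \<open>With \<open>S\<close> the self-adjoint operator obtained from the square root of
  \<open>f\<close>, the quadratic form of \<open>S o\<^sub>L S\<close> at \<open>x\<close> is the
  square of \<open>norm (S x)\<close>.\<close>

lemma fun_calc_positive:
  assumes f: "continuous_on {a..b} f" and "\<And>t. t \<in> {a..b} \<Longrightarrow> f t \<ge> 0"
  shows "positive_op (fun_calc f T)"
proof -
  define S where "S = fun_calc (\<lambda>t. sqrt (f t)) T"
  have cont: "continuous_on {a..b} (\<lambda>t. sqrt (f t))"
    by (intro continuous_intros f)
  have S: "self_adjoint_op S"
    unfolding S_def by (rule fun_calc_self_adjoint[OF cont])
  have "fun_calc f T = fun_calc (\<lambda>t. sqrt (f t) * sqrt (f t)) T"
    by (rule fun_calc_cong) (simp add: assms(2))
  also have "\<dots> = S o\<^sub>L S"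
    unfolding S_def by (rule fun_calc_mult[OF cont cont])
  finally have *: "fun_calc f T = S o\<^sub>L S" .
  show ?thesis
    unfolding positive_op_def *
  proof (intro conjI allI)
    show "S o\<^sub>L S \<in> bounded_ops"
      using S by (simp add: bounded_ops_compose self_adjoint_bounded_ops)
    show "cinner x ((S o\<^sub>L S) x) \<in> \<real>\<^sub>\<ge>\<^sub>0" for x
      by (simp add: self_adjoint_cinner[OF S, symmetric] cinner_self del: of_real_power)
  qed
qed

end

subsection \<open>Strictly positive operators\<close>

lemma positive_op_Re_cinner: "positive_op T \<Longrightarrow> 0 \<le> Re (cinner x (T x))"
  by (simp add: positive_op_def complex_nonneg_Reals_iff)

lemma positive_op_conjugate:
  assumes "self_adjoint_op S" and "positive_op T"
  shows "positive_op (S o\<^sub>L T o\<^sub>L S)"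
  using assms by (simp add: positive_op_def bounded_ops_compose self_adjoint_bounded_ops
      flip: self_adjoint_cinner)

lemma Re_cinner_le_norm_blinfun:
  fixes T :: "'a::complex_hilbert_space \<Rightarrow>\<^sub>L 'a"
  shows "Re (cinner x (T x)) \<le> norm T * (norm x)\<^sup>2"
proof -
  have "Re (cinner x (T x)) \<le> norm x * norm (T x)"
    by (rule Re_cinner_le_norm)
  also have "\<dots> \<le> norm x * (norm T * norm x)"
    by (intro mult_left_mono norm_blinfun) simp
  finally show ?thesis
    by (simp add: power2_eq_square ac_simps)
qed

text \<open>Expanding \<open>0 \<le> \<langle>y, T y\<rangle>\<close> at \<open>y = x - s T x\<close>, where \<open>s \<parallel>T\<parallel> \<le> 1\<close>, gives
  \<open>s \<parallel>T x\<parallel>\<^sup>2 \<le> \<langle>x, T x\<rangle>\<close>.\<close>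

lemma strictly_positive_op_coercive:
  fixes T :: "'a::complex_hilbert_space \<Rightarrow>\<^sub>L 'a"
  assumes T: "self_adjoint_op T" and "strictly_positive_op T"
  obtains m where "m > 0" and "\<And>x. m * (norm x)\<^sup>2 \<le> Re (cinner x (T x))"
proof -
  have pos: "positive_op T" and "invertible_op T"
    using assms(2) by (auto simp: strictly_positive_op_def)
  then obtain K where K: "K > 0" "\<And>x. norm x \<le> K * norm (T x)"
    using invertible_op_bounded_below by blast
  \<comment> \<open>The summand 1 avoids division by zero and still gives
    \<open>s * norm T \<le> 1\<close>.\<close>
  define s where "s = 1 / (norm T + 1)"
  have s: "s > 0" "s * norm T \<le> 1"
    by (simp_all add: s_def add_nonneg_pos divide_simps)
  have "s / K\<^sup>2 * (norm x)\<^sup>2 \<le> Re (cinner x (T x))" for x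
  proof -
    have "0 \<le> Re (cinner (x - s *\<^sub>R T x) (T (x - s *\<^sub>R T x)))"
      by (rule positive_op_Re_cinner[OF pos])
    also have "\<dots> = Re (cinner x (T x)) - 2 * s * (norm (T x))\<^sup>2 + s\<^sup>2 * Re (cinner (T x) (T (T x)))"
      by (simp add: blinfun.bilinear_simps cinner_diff_left cinner_diff_right cinner_scaleR_left
          cinner_scaleR_right self_adjoint_cinner[OF T, of x "T x", symmetric] cinner_self
          power2_eq_square algebra_simps)
    finally have 1: "2 * s * (norm (T x))\<^sup>2 \<le> Re (cinner x (T x)) + s\<^sup>2 * Re (cinner (T x) (T (T x)))"
      by simp
    \<comment> \<open>The quadratic term is absorbed by half of the linear term
      \<open>2 * s * (norm (T x))^2\<close>.\<close>
    have "s\<^sup>2 * Re (cinner (T x) (T (T x))) \<le> s\<^sup>2 * (norm T * (norm (T x))\<^sup>2)"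
      by (intro mult_left_mono Re_cinner_le_norm_blinfun) simp
    also have "\<dots> = (s * norm T) * (s * (norm (T x))\<^sup>2)"
      by (simp add: power2_eq_square)
    also have "\<dots> \<le> 1 * (s * (norm (T x))\<^sup>2)"
      using s by (intro mult_right_mono) auto
    finally have 2: "s * (norm (T x))\<^sup>2 \<le> Re (cinner x (T x))"
      using 1 by simp
    have "(norm x)\<^sup>2 \<le> (K * norm (T x))\<^sup>2"
      using K by (intro power_mono) auto
    then have "s * (norm x)\<^sup>2 \<le> s * (K\<^sup>2 * (norm (T x))\<^sup>2)"
      using s by (intro mult_left_mono) (auto simp: power_mult_distrib)
    then have "s / K\<^sup>2 * (norm x)\<^sup>2 \<le> s * (norm (T x))\<^sup>2"
      using K(1) by (simp add: field_simps)
    with 2 show ?thesis by simp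
  qed
  with s K(1) show ?thesis
    using that[of "s / K\<^sup>2"] by simp
qed

lemma spectral_interval_bounds:
  assumes "self_adjoint_op T" and "\<And>x. a * (norm x)\<^sup>2 \<le> Re (cinner x (T x))"
    and "\<And>x. Re (cinner x (T x)) \<le> b * (norm x)\<^sup>2"
  shows "spectral_interval T a b"
proof
  show "real_spectrum T \<subseteq> {a..b}"
    using real_spectrum_lower[OF assms(1,2)] real_spectrum_upper[OF assms(1,3)] by auto
qed (fact assms(1))

subsection \<open>Monotonicity in the exponent\<close>

definition entropy_fun :: "real \<Rightarrow> real \<Rightarrow> real"
  where "entropy_fun r t = (t powr r - 1) / r - (1 / 2) * (t powr r * ln t)"

text \<open>In the derivative everything cancels except \<open>- z^2 / 2 * exp z\<close>. Comparison
  with the value \<open>-1\<close> at 0 gives the sign of the numerator in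
  \<open>entropy_fun_has_derivative\<close>.\<close>

lemma exp_times_quadratic_antimono:
  fixes x y :: real
  assumes "x \<le> y"
  shows "exp y * (y - 1 - y\<^sup>2 / 2) \<le> exp x * (x - 1 - x\<^sup>2 / 2)"
proof (rule DERIV_nonpos_imp_nonincreasing[OF assms])
  fix z :: real
  have "((\<lambda>z. exp z * (z - 1 - z\<^sup>2 / 2)) has_real_derivative - (z\<^sup>2 / 2 * exp z)) (at z)"
    by (auto intro!: derivative_eq_intros simp: algebra_simps)
  then show "\<exists>D. ((\<lambda>z. exp z * (z - 1 - z\<^sup>2 / 2)) has_real_derivative D) (at z) \<and> D \<le> 0"
    by (intro exI[of _ "- (z\<^sup>2 / 2 * exp z)"]) simp
qed

lemma entropy_fun_has_derivative:
  assumes "t > 0" and "r \<noteq> 0"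
  shows "((\<lambda>r. entropy_fun r t) has_real_derivative
    (exp (r * ln t) * (r * ln t - 1 - (r * ln t)\<^sup>2 / 2) + 1) / r\<^sup>2) (at r)"
proof -
  have "((\<lambda>r. (exp (r * ln t) - 1) / r - (1 / 2) * (exp (r * ln t) * ln t)) has_real_derivative
    (exp (r * ln t) * (r * ln t - 1 - (r * ln t)\<^sup>2 / 2) + 1) / r\<^sup>2) (at r)"
    using \<open>r \<noteq> 0\<close> by (auto intro!: derivative_eq_intros simp: field_simps power2_eq_square)
  then show ?thesis
    using \<open>t > 0\<close> by (simp add: entropy_fun_def powr_def)
qed

text \<open>Exponents of one sign keep the singularity \<open>r = 0\<close> out of
  \<open>[p, q]\<close>, and the sign conditions at the endpoints extend to \<open>r * ln t\<close>
  for all \<open>r\<close> in between.\<close>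

lemma entropy_fun_mono:
  assumes "t > 0" and "p \<le> q" and "0 < p \<or> q < 0" and "p * ln t \<le> 0" and "q * ln t \<le> 0"
  shows "entropy_fun p t \<le> entropy_fun q t"
proof (rule DERIV_nonneg_imp_nondecreasing[OF assms(2)])
  fix r assume r: "p \<le> r" "r \<le> q"
  then have "r \<noteq> 0" using assms(3) by auto
  have "r * ln t \<le> 0"
    using r assms(3-5) by (auto simp: mult_le_0_iff)
  then have "exp 0 * (0 - 1 - 0\<^sup>2 / 2) \<le> exp (r * ln t) * (r * ln t - 1 - (r * ln t)\<^sup>2 / 2)"
    by (rule exp_times_quadratic_antimono)
  then have "0 \<le> (exp (r * ln t) * (r * ln t - 1 - (r * ln t)\<^sup>2 / 2) + 1) / r\<^sup>2"
    by (intro divide_nonneg_nonneg) auto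
  then show "\<exists>D. ((\<lambda>r. entropy_fun r t) has_real_derivative D) (at r) \<and> 0 \<le> D"
    using entropy_fun_has_derivative[OF assms(1) \<open>r \<noteq> 0\<close>] by blast
qed

lemma entropy_fun_antimono:
  assumes "t > 0" and "p \<le> q" and "0 < p \<or> q < 0" and "0 \<le> p * ln t" and "0 \<le> q * ln t"
  shows "entropy_fun q t \<le> entropy_fun p t"
proof (rule DERIV_nonpos_imp_nonincreasing[OF assms(2)])
  fix r assume r: "p \<le> r" "r \<le> q"
  then have "r \<noteq> 0" using assms(3) by auto
  have "0 \<le> r * ln t"
    using r assms(3-5) by (auto simp: zero_le_mult_iff)
  then have "exp (r * ln t) * (r * ln t - 1 - (r * ln t)\<^sup>2 / 2) \<le> exp 0 * (0 - 1 - 0\<^sup>2 / 2)"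
    by (rule exp_times_quadratic_antimono)
  then have "(exp (r * ln t) * (r * ln t - 1 - (r * ln t)\<^sup>2 / 2) + 1) / r\<^sup>2 \<le> 0"
    by (intro divide_nonpos_nonneg) auto
  then show "\<exists>D. ((\<lambda>r. entropy_fun r t) has_real_derivative D) (at r) \<and> D \<le> 0"
    using entropy_fun_has_derivative[OF assms(1) \<open>r \<noteq> 0\<close>] by blast
qed

lemma continuous_on_entropy_fun: "u > 0 \<Longrightarrow> continuous_on {u..v} (entropy_fun r)"
  unfolding entropy_fun_def[abs_def] divide_inverse by (intro continuous_intros) auto

subsection \<open>Relative operator entropies\<close>

lemma op_powr_half:
  assumes "spectral_interval A a b" and "a > 0"
  shows "self_adjoint_op (A powr\<^sub>o\<^sub>p (1/2))"
    and "A powr\<^sub>o\<^sub>p (1/2) o\<^sub>L A powr\<^sub>o\<^sub>p (1/2) = A"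
    and "self_adjoint_op (A powr\<^sub>o\<^sub>p (- 1/2))"
    and "A powr\<^sub>o\<^sub>p (- 1/2) o\<^sub>L (A o\<^sub>L A powr\<^sub>o\<^sub>p (- 1/2)) = id_blinfun"
proof -
  interpret spectral_interval A a b by fact
  have cont: "continuous_on {a..b} (\<lambda>t. t powr r)" for r :: real
    using \<open>a > 0\<close> by (intro continuous_intros) auto
  show "self_adjoint_op (A powr\<^sub>o\<^sub>p (1/2))" "self_adjoint_op (A powr\<^sub>o\<^sub>p (- 1/2))"
    unfolding op_powr_def by (intro fun_calc_self_adjoint cont)+
  have "A powr\<^sub>o\<^sub>p (1/2) o\<^sub>L A powr\<^sub>o\<^sub>p (1/2) = fun_calc (\<lambda>t. t powr (1/2) * t powr (1/2)) A"
    unfolding op_powr_def by (rule fun_calc_mult[OF cont cont, symmetric])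
  also have "\<dots> = fun_calc (\<lambda>t. t) A"
    using \<open>a > 0\<close> by (intro fun_calc_cong) (auto simp flip: powr_add)
  finally show "A powr\<^sub>o\<^sub>p (1/2) o\<^sub>L A powr\<^sub>o\<^sub>p (1/2) = A"
    by (simp add: fun_calc_ident)
  have "A powr\<^sub>o\<^sub>p (- 1/2) o\<^sub>L (A o\<^sub>L A powr\<^sub>o\<^sub>p (- 1/2))
      = fun_calc (\<lambda>t. t powr (- 1/2) * (t * t powr (- 1/2))) A"
    unfolding op_powr_def
    by (simp only: fun_calc_mult continuous_on_mult cont continuous_on_id fun_calc_ident)
  also have "\<dots> = fun_calc (\<lambda>_. 1) A"
  proof (rule fun_calc_cong)
    fix t assume "t \<in> {a..b}"
    then have "t > 0" using \<open>a > 0\<close> by auto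
    \<comment> \<open>Writing \<open>t\<close> as \<open>t powr 1\<close> lets the exponents add up
      to 0.\<close>
    then have "t powr (- 1/2) * (t powr 1 * t powr (- 1/2)) = 1"
      unfolding powr_add[symmetric] by simp
    then show "t powr (- 1/2) * (t * t powr (- 1/2)) = 1"
      using \<open>t > 0\<close> by (simp only: powr_one)
  qed
  finally show "A powr\<^sub>o\<^sub>p (- 1/2) o\<^sub>L (A o\<^sub>L A powr\<^sub>o\<^sub>p (- 1/2)) = id_blinfun"
    by (simp add: fun_calc_const)
qed

text \<open>Evaluate the bounds \<open>u A \<le> B \<le> v A\<close> at \<open>C x\<close> with
  \<open>C\<close> the inverse square root of \<open>A\<close>: since \<open>C A C\<close> is the
  identity, the form of \<open>A\<close> at \<open>C x\<close> is the square of
  \<open>norm x\<close>.\<close>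

lemma spectral_interval_rel_op:
  assumes A: "spectral_interval A a b" and "a > 0"
    and lower: "u *\<^sub>R A \<le>\<^sub>o\<^sub>p B" and upper: "B \<le>\<^sub>o\<^sub>p v *\<^sub>R A"
  shows "spectral_interval (rel_op A B) u v"
proof -
  define C where "C = A powr\<^sub>o\<^sub>p (- 1/2)"
  have C: "self_adjoint_op C" and "C o\<^sub>L (A o\<^sub>L C) = id_blinfun"
    using op_powr_half[OF A \<open>a > 0\<close>] by (simp_all add: C_def)
  then have CAC: "C (A (C x)) = x" for x
    using blinfun_compose_eq_id_apply[of C "A o\<^sub>L C" x] by simp
  have rel: "rel_op A B x = C (B (C x))" for x
    by (simp add: rel_op_def C_def)
  have B_bounds: "u * Re (cinner y (A y)) \<le> Re (cinner y (B y))"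
    "Re (cinner y (B y)) \<le> v * Re (cinner y (A y))" for y
    using lower upper positive_op_Re_cinner[of "B - u *\<^sub>R A" y] positive_op_Re_cinner[of "v *\<^sub>R A - B" y]
    by (simp_all add: op_le_def blinfun.bilinear_simps cinner_diff_right cinner_scaleR_right)
  have form: "Re (cinner x (rel_op A B x)) = Re (cinner (C x) (B (C x)))"
    "(norm x)\<^sup>2 = Re (cinner (C x) (A (C x)))" for x
    by (simp_all add: rel self_adjoint_cinner[OF C] CAC Re_cinner_self)
  show ?thesis
  proof (rule spectral_interval_bounds)
    show "self_adjoint_op (rel_op A B)"
      unfolding rel_op_def C_def[symmetric] using C lower
      by (simp add: self_adjoint_conjugate op_le_def)
    show "u * (norm x)\<^sup>2 \<le> Re (cinner x (rel_op A B x))"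
      "Re (cinner x (rel_op A B x)) \<le> v * (norm x)\<^sup>2" for x
      unfolding form by (rule B_bounds)+
  qed
qed

text \<open>The constant \<open>-1\<close> in \<open>entropy_fun\<close> gives minus the identity,
  which conjugation turns into the term \<open>- A\<close>, as
  \<open>D o\<^sub>L D = A\<close>.\<close>

lemma tsallis_minus_gen_rel_entropy:
  assumes "spectral_interval A a b" and "a > 0"
    and "spectral_interval (rel_op A B) u v" and "u > 0"
  shows "tsallis_rel_entropy r A B - (1/2) *\<^sub>R gen_rel_entropy r A B =
    A powr\<^sub>o\<^sub>p (1/2) o\<^sub>L fun_calc (entropy_fun r) (rel_op A B) o\<^sub>L A powr\<^sub>o\<^sub>p (1/2)"
proof -
  interpret spectral_interval "rel_op A B" u v by fact
  define X where "X = rel_op A B"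
  define D where "D = A powr\<^sub>o\<^sub>p (1/2)"
  have D: "D o\<^sub>L D = A"
    unfolding D_def by (rule op_powr_half[OF assms(1,2)])
  have cont: "continuous_on {u..v} (\<lambda>t. t powr r)" "continuous_on {u..v} ln"
    using \<open>u > 0\<close> by (auto intro!: continuous_intros)
  have "fun_calc (entropy_fun r) X
      = fun_calc (\<lambda>t. (1 / r) * (t powr r - 1) - (1 / 2) * (t powr r * ln t)) X"
    by (simp add: entropy_fun_def[abs_def])
  also have "\<dots> = (1 / r) *\<^sub>R (X powr\<^sub>o\<^sub>p r - id_blinfun) - (1 / 2) *\<^sub>R (X powr\<^sub>o\<^sub>p r o\<^sub>L op_ln X)"
    unfolding op_powr_def op_ln_def X_def
    by (simp only: fun_calc_diff fun_calc_scale fun_calc_mult fun_calc_const cont scaleR_one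
        continuous_on_diff continuous_on_mult continuous_on_const)
  finally show ?thesis
    unfolding tsallis_rel_entropy_def gen_rel_entropy_def X_def[symmetric] D_def[symmetric]
    by (simp add: blinfun_compose_simps D)
qed

text \<open>The scalar inequality gives a positive operator, and conjugation by the self-adjoint
  square root of \<open>A\<close> preserves positivity.\<close>

lemma tsallis_minus_gen_rel_entropy_mono:
  assumes "spectral_interval A a b" and "a > 0"
    and "spectral_interval (rel_op A B) u v" and "u > 0"
    and le: "\<And>t. t \<in> {u..v} \<Longrightarrow> entropy_fun r t \<le> entropy_fun s t"
  shows "tsallis_rel_entropy r A B - (1/2) *\<^sub>R gen_rel_entropy r A B
    \<le>\<^sub>o\<^sub>p tsallis_rel_entropy s A B - (1/2) *\<^sub>R gen_rel_entropy s A B"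
proof -
  interpret spectral_interval "rel_op A B" u v by fact
  define D where "D = A powr\<^sub>o\<^sub>p (1/2)"
  have D: "self_adjoint_op D"
    unfolding D_def by (rule op_powr_half[OF assms(1,2)])
  note cont = continuous_on_entropy_fun[OF \<open>u > 0\<close>, of v]
  have "positive_op (fun_calc (\<lambda>t. entropy_fun s t - entropy_fun r t) (rel_op A B))"
    using le by (intro fun_calc_positive continuous_on_diff cont) auto
  then have "positive_op (D o\<^sub>L (fun_calc (entropy_fun s) (rel_op A B)
      - fun_calc (entropy_fun r) (rel_op A B)) o\<^sub>L D)"
    using D by (simp add: fun_calc_diff cont positive_op_conjugate)
  then show ?thesis
    unfolding op_le_def tsallis_minus_gen_rel_entropy[OF assms(1-4)] D_def[symmetric]
    using D by (simp add: blinfun_compose_simps(1-4) self_adjoint_conjugate fun_calc_self_adjoint cont)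
qed

theorem proposition3p4:
  fixes A B :: "'a::complex_hilbert_space \<Rightarrow>\<^sub>L 'a" and u v p q :: real
  assumes "strictly_positive_op A" and "strictly_positive_op B"
    and "u > 0" and "v > 0"
    and "u *\<^sub>R A \<le>\<^sub>o\<^sub>p B" and "B \<le>\<^sub>o\<^sub>p v *\<^sub>R A"
    and "p \<in> {-1..1} - {0}" and "q \<in> {-1..1} - {0}"
  shows
    "((u \<ge> 1 \<and> -1 \<le> p \<and> p \<le> q \<and> q < 0) \<or> (v \<le> 1 \<and> 0 < p \<and> p \<le> q \<and> q \<le> 1) \<longrightarrow>
        tsallis_rel_entropy p A B - (1/2) *\<^sub>R gen_rel_entropy p A B
          \<le>\<^sub>o\<^sub>p tsallis_rel_entropy q A B - (1/2) *\<^sub>R gen_rel_entropy q A B) \<and>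
     ((u \<ge> 1 \<and> 0 < p \<and> p \<le> q \<and> q \<le> 1) \<or> (v \<le> 1 \<and> -1 \<le> p \<and> p \<le> q \<and> q < 0) \<longrightarrow>
        tsallis_rel_entropy q A B - (1/2) *\<^sub>R gen_rel_entropy q A B
          \<le>\<^sub>o\<^sub>p tsallis_rel_entropy p A B - (1/2) *\<^sub>R gen_rel_entropy p A B)"
proof -
  \<comment> \<open>The order relation includes self-adjointness of \<open>u A\<close>; scaling by
    \<open>1 / u\<close> passes it to \<open>A\<close>.\<close>
  have A: "self_adjoint_op A"
    using self_adjoint_scaleR[of "u *\<^sub>R A" "inverse u"] assms(3,5) by (simp add: op_le_def)
  obtain a where "a > 0" and "\<And>x. a * (norm x)\<^sup>2 \<le> Re (cinner x (A x))"
    using strictly_positive_op_coercive[OF A assms(1)] by blast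
  then have A_int: "spectral_interval A a (norm A)"
    using A by (intro spectral_interval_bounds Re_cinner_le_norm_blinfun)
  note X_int = spectral_interval_rel_op[OF A_int \<open>a > 0\<close> assms(5,6)]
  note mono = tsallis_minus_gen_rel_entropy_mono[OF A_int \<open>a > 0\<close> X_int \<open>u > 0\<close>]
  \<comment> \<open>On \<open>[u, v]\<close>, \<open>u \<ge> 1\<close> gives
    \<open>ln t \<ge> 0\<close> and \<open>v \<le> 1\<close> gives \<open>ln t \<le> 0\<close>; the
    sign of the exponents then fixes that of \<open>r * ln t\<close>.\<close>
  have "entropy_fun p t \<le> entropy_fun q t"
    if "(u \<ge> 1 \<and> p \<le> q \<and> q < 0) \<or> (v \<le> 1 \<and> 0 < p \<and> p \<le> q)" "t \<in> {u..v}" for t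
    using that \<open>u > 0\<close> by (intro entropy_fun_mono) (auto simp: mult_le_0_iff)
  moreover have "entropy_fun q t \<le> entropy_fun p t"
    if "(u \<ge> 1 \<and> 0 < p \<and> p \<le> q) \<or> (v \<le> 1 \<and> p \<le> q \<and> q < 0)" "t \<in> {u..v}" for t
    using that \<open>u > 0\<close> by (intro entropy_fun_antimono) (auto simp: zero_le_mult_iff)
  ultimately show ?thesis
    by (intro conjI impI mono) blast+
qed

end
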